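(* For all integers $r,n$ with $n\ge 0$, $$(-1)^{rn}\sum_{k=0}^n\frac{\binom{n}{k}}{\binom{2k}{k}}2^{2k}(-1)^{k+1}L_r^{n-k} F_{r(n+k)}=\sum_{k=0}^n\binom{n}{k}(-1)^{rk}\frac{F_{2rk}}{2k-1} =\frac{2^{2n}}{\binom{2n}{n}}\sum_{k=0}^n\binom{2k}{k}(-1)^{rk}\frac{2^{-2k} F_{rk}L_r^k}{2k-1}.$$
   Context: The Fibonacci numbers $F_m$ ($m\in\mathbb Z$) are defined by $F_0=0$, $F_1=1$ and $F_{m+2}=F_{m+1}+F_m$ for all $m\in\mathbb Z$. The Lucas numbers $L_m$ ($m\in\mathbb Z$) satisfy the same recursion with $L_0=2$, $L_1=1$. *)

theory Defs
  imports Complex_Main "HOL-Number_Theory.Fib"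
begin

text \<open>
  The library function \<open>fib\<close> lives on the natural numbers only, so the Fibonacci and Lucas
  numbers are defined here on all integers. The last branch is the recursion
  \<open>F (m + 2) = F (m + 1) + F m\<close> solved for \<open>F m\<close>, which extends the sequence to negative indices.
\<close>

function fibonacci :: "int \<Rightarrow> int" where
  "fibonacci m =
     (if m = 0 then 0
      else if m = 1 then 1
      else if m > 1 then fibonacci (m - 1) + fibonacci (m - 2)
      else fibonacci (m + 2) - fibonacci (m + 1))"
  by pat_completeness auto
termination
  by (relation "measure (\<lambda>m. nat (if m < 0 then 2 - m else m))") auto

function lucas :: "int \<Rightarrow> int" where
  "lucas m =
     (if m = 0 then 2
      else if m = 1 then 1
      else if m > 1 then lucas (m - 1) + lucas (m - 2)
      else lucas (m + 2) - lucas (m + 1))"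
  by pat_completeness auto
termination
  by (relation "measure (\<lambda>m. nat (if m < 0 then 2 - m else m))") auto

declare fibonacci.simps [simp del] lucas.simps [simp del]

lemma fibonacci_0 [simp]: "fibonacci 0 = 0"
  and fibonacci_1 [simp]: "fibonacci 1 = 1"
  by (simp_all add: fibonacci.simps)

lemma lucas_0 [simp]: "lucas 0 = 2"
  and lucas_1 [simp]: "lucas 1 = 1"
  by (simp_all add: lucas.simps)

lemma fibonacci_rec: "fibonacci (m + 2) = fibonacci (m + 1) + fibonacci m"
proof (cases "m < 0")
  case True
  then show ?thesis using fibonacci.simps [of m] by simp
next
  case False
  then show ?thesis using fibonacci.simps [of "m + 2"] by (simp add: algebra_simps)
qed

lemma lucas_rec: "lucas (m + 2) = lucas (m + 1) + lucas m"
proof (cases "m < 0")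
  case True
  then show ?thesis using lucas.simps [of m] by simp
next
  case False
  then show ?thesis using lucas.simps [of "m + 2"] by (simp add: algebra_simps)
qed

lemma fibonacci_of_nat: "fibonacci (int n) = int (fib n)"
proof (induction n rule: fib.induct)
  case (3 n)
  then show ?case using fibonacci_rec [of "int n"] by (simp add: algebra_simps)
qed simp_all

end

theory Submission
  imports Defs
begin

text \<open>
  Let \<open>x = \<phi>\<^sup>r\<close> and \<open>y = \<psi>\<^sup>r\<close> with \<open>\<phi>, \<psi>\<close> the two roots of \<open>z\<^sup>2 = z + 1\<close>, so that
  \<open>e = x y = (-1)\<^sup>r\<close>, \<open>L\<^sub>r = x + y\<close> and \<open>F\<^bsub>r m\<^esub> = (x\<^sup>m - y\<^sup>m) / \<surd>5\<close>. By Binet's formula each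
  of the three expressions is, up to the factor \<open>1 / \<surd>5\<close>, the difference of the values of
  one polynomial at \<open>t = e x\<^sup>2\<close> and at \<open>t = e y\<^sup>2\<close>, because \<open>1 + e x\<^sup>2 = e x L\<^sub>r\<close> and likewise
  for \<open>y\<close>. Writing \<open>\<gamma>\<^sub>k\<close> for \<open>4\<^sup>k\<close> divided by the \<open>k\<close>-th central binomial coefficient, the
  theorem therefore follows from the polynomial identities
  \<open>- (\<Sum>k\<le>n. (n choose k) \<gamma>\<^sub>k (-t)\<^sup>k (1 + t)\<^bsup>n-k\<^esup>)\<close>
  \<open>= (\<Sum>k\<le>n. (n choose k) t\<^sup>k / (2k - 1))\<close>
  \<open>= \<gamma>\<^sub>n (\<Sum>k\<le>n. (1 + t)\<^sup>k / (\<gamma>\<^sub>k (2k - 1)))\<close>.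

  All three polynomials have the value \<open>-1\<close> at \<open>n = 0\<close> and satisfy the recurrence
  \<open>(2n + 1) f\<^bsub>n+1\<^esub> = 2 (n + 1) f\<^sub>n + (1 + t)\<^bsup>n+1\<^esup>\<close>. For the last one this is the recurrence of
  \<open>\<gamma>\<close>; for the other two it is a comparison of coefficients, in powers of \<open>t\<close> for the middle
  sum and in the monomials \<open>(-t)\<^sup>k (1 + t)\<^bsup>n+1-k\<^esup>\<close> for the first.
\<close>

definition central_ratio :: "nat \<Rightarrow> real" where
  "central_ratio k = 4 ^ k / real ((2 * k) choose k)"

lemma central_ratio_0 [simp]: "central_ratio 0 = 1"
  by (simp add: central_ratio_def)

lemma central_ratio_pos: "central_ratio k > 0"
  by (simp add: central_ratio_def)

lemma central_binomial_Suc: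
  "Suc n * ((2 * Suc n) choose Suc n) = 2 * (2 * n + 1) * ((2 * n) choose n)"
proof -
  have "Suc n * ((2 * Suc n) choose Suc n) = (2 * Suc n) * ((2 * n + 1) choose n)"
    using Suc_times_binomial [of n "2 * n + 1"] by simp
  also have "(2 * n + 1) choose n = (2 * n + 1) choose Suc n"
    using binomial_symmetric [of n "2 * n + 1"] by simp
  also have "(2 * Suc n) * ((2 * n + 1) choose Suc n)
      = 2 * (Suc n * (Suc (2 * n) choose Suc n))"
    by simp
  also have "Suc n * (Suc (2 * n) choose Suc n) = Suc (2 * n) * ((2 * n) choose n)"
    by (rule Suc_times_binomial)
  finally show ?thesis by simp
qed

lemma central_ratio_Suc:
  "(2 * real n + 1) * central_ratio (Suc n) = 2 * (real n + 1) * central_ratio n"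
proof -
  have "real (Suc n * ((2 * Suc n) choose Suc n)) = real (2 * (2 * n + 1) * ((2 * n) choose n))"
    by (simp only: central_binomial_Suc)
  then have eq: "(real n + 1) * real ((2 * Suc n) choose Suc n)
      = 2 * (2 * real n + 1) * real ((2 * n) choose n)"
    by (simp only: of_nat_mult of_nat_add of_nat_Suc of_nat_numeral of_nat_1 add.commute)
  have pos: "real ((2 * Suc n) choose Suc n) > 0" "real ((2 * n) choose n) > 0"
    by (simp_all del: binomial_Suc_Suc)
  have "4 * (2 * real n + 1) * real ((2 * n) choose n)
      = 2 * (real n + 1) * real ((2 * Suc n) choose Suc n)"
    using eq by linarith
  then have "4 ^ n * (4 * (2 * real n + 1) * real ((2 * n) choose n))
      = 4 ^ n * (2 * (real n + 1) * real ((2 * Suc n) choose Suc n))"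
    by simp
  then show ?thesis
    using pos unfolding central_ratio_def times_divide_eq_right
    by (subst frac_eq_eq) (simp_all only: power_Suc mult_ac neq_iff, simp_all)
qed

lemma odd_nonzero: "2 * real k - 1 \<noteq> 0"
proof
  assume "2 * real k - 1 = 0"
  then have "real (2 * k) = real 1" by simp
  then have "2 * k = 1" by (simp only: of_nat_eq_iff)
  then show False by presburger
qed

section \<open>Three solutions of one recurrence\<close>

text \<open>
  Coefficient of \<open>t\<^sup>k\<close>: since \<open>2n + 1 = 2 (n + 1 - k) + (2k - 1)\<close>, the absorption rule
  \<open>(n + 1 - k) (n + 1 choose k) = (n + 1) (n choose k)\<close> accounts for \<open>2 (n + 1) f\<^sub>n\<close>, and the
  summand \<open>2k - 1\<close> cancels the denominator and leaves the binomial expansion of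
  \<open>(1 + t)\<^bsup>n+1\<^esup>\<close>.
\<close>

lemma binomial_odd_sum_Suc:
  fixes t :: real
  shows "(2 * real n + 1) * (\<Sum>k\<le>Suc n. real (Suc n choose k) * t ^ k / (2 * real k - 1))
    = 2 * (real n + 1) * (\<Sum>k\<le>n. real (n choose k) * t ^ k / (2 * real k - 1)) + (1 + t) ^ Suc n"
proof -
  have coeff: "(2 * real n + 1) * (real (Suc n choose k) * t ^ k / (2 * real k - 1))
      = 2 * (real n + 1) * (real (n choose k) * t ^ k / (2 * real k - 1))
        + real (Suc n choose k) * t ^ k" if "k \<le> Suc n" for k
  proof -
    have "(real n + 1 - real k) * real (Suc n choose k) = (real n + 1) * real (n choose k)"
      using that
    proof (cases "k = Suc n")
      case False
      then have "k \<le> n" using that by simp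
      have "real ((Suc n - k) * (Suc n choose k)) = real (Suc n * (n choose k))"
        using binomial_absorb_comp [of "Suc n" k] by simp
      moreover have "real (Suc n - k) = real n + 1 - real k"
        using \<open>k \<le> n\<close> by (simp add: of_nat_diff)
      ultimately show ?thesis
        by (simp only: of_nat_mult of_nat_Suc add.commute)
    qed simp
    then have "(2 * real n + 1) * real (Suc n choose k)
        = 2 * (real n + 1) * real (n choose k) + (2 * real k - 1) * real (Suc n choose k)"
      by (simp add: algebra_simps)
    then have "(2 * real n + 1) * real (Suc n choose k) * (t ^ k / (2 * real k - 1))
        = (2 * (real n + 1) * real (n choose k) + (2 * real k - 1) * real (Suc n choose k))
          * (t ^ k / (2 * real k - 1))"
      by simp
    then show ?thesis using odd_nonzero [of k] by (simp add: field_simps)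
  qed
  have "(1 + t) ^ Suc n = (\<Sum>k\<le>Suc n. real (Suc n choose k) * t ^ k)"
    using binomial_ring [of t 1 "Suc n"] by (simp add: add.commute)
  moreover have "(\<Sum>k\<le>Suc n. real (n choose k) * t ^ k / (2 * real k - 1))
      = (\<Sum>k\<le>n. real (n choose k) * t ^ k / (2 * real k - 1))"
    by simp
  moreover have "(2 * real n + 1) * (\<Sum>k\<le>Suc n. real (Suc n choose k) * t ^ k / (2 * real k - 1))
      = 2 * (real n + 1) * (\<Sum>k\<le>Suc n. real (n choose k) * t ^ k / (2 * real k - 1))
        + (\<Sum>k\<le>Suc n. real (Suc n choose k) * t ^ k)"
    unfolding sum_distrib_left sum.distrib [symmetric]
    by (rule sum.cong [OF refl], rule coeff) simp
  ultimately show ?thesis by simp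
qed

text \<open>
  At \<open>u = 1 + t\<close> this is the recurrence for the negative of the sum. The factor \<open>u - t\<close>, equal
  to \<open>1\<close> there, makes both sides homogeneous of degree \<open>n + 1\<close>, and the identity then holds for
  independent \<open>t\<close> and \<open>u\<close>, so that the coefficients of \<open>(-t)\<^sup>k u\<^bsup>n+1-k\<^esup>\<close> can be compared.
  The product of \<open>u - t\<close> and the sum has the coefficient
  \<open>(n choose k) \<gamma>\<^sub>k + (n choose k-1) \<gamma>\<^bsub>k-1\<^esub>\<close>, where \<open>\<gamma>\<^bsub>k-1\<^esub> = (1 - 1 / (2k)) \<gamma>\<^sub>k\<close> for \<open>k > 0\<close>.
  Pascal's rule and \<open>(n + 1) (n choose k-1) = k (n + 1 choose k)\<close> then give the claim for
  \<open>k > 0\<close>. At \<open>k = 0\<close> the coefficients are \<open>2n + 1\<close> and \<open>2 (n + 1)\<close>, and the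
  last term makes up for the difference.
\<close>

lemma homogeneous_central_sum_Suc:
  fixes t u :: real
  shows "(2 * real n + 1)
      * (\<Sum>k\<le>Suc n. real (Suc n choose k) * central_ratio k * (- t) ^ k * u ^ (Suc n - k))
    = 2 * (real n + 1) * (u - t)
      * (\<Sum>k\<le>n. real (n choose k) * central_ratio k * (- t) ^ k * u ^ (n - k)) - u ^ Suc n"
proof -
  define A where "A k = real (n choose k) * central_ratio k * (- t) ^ k * u ^ (Suc n - k)" for k
  define B where "B k = real (n choose k) * central_ratio k * (- t) ^ Suc k * u ^ (n - k)" for k
  \<comment> \<open>\<open>A\<close> collects the products with \<open>u\<close> and \<open>B\<close> those with \<open>- t\<close>; \<open>B k\<close> belongs to the same
    monomial as \<open>A (Suc k)\<close>.\<close>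
  have "(u - t) * (\<Sum>k\<le>n. real (n choose k) * central_ratio k * (- t) ^ k * u ^ (n - k))
      = (\<Sum>k\<le>n. A k) + (\<Sum>k\<le>n. B k)"
    unfolding A_def B_def sum_distrib_left sum.distrib [symmetric]
    by (rule sum.cong) (simp_all add: Suc_diff_le algebra_simps)
  also have "(\<Sum>k\<le>n. A k) = (\<Sum>k\<le>Suc n. A k)"
    by (simp add: A_def)
  also have "\<dots> = u ^ Suc n + (\<Sum>k\<le>n. A (Suc k))"
    by (subst sum.atMost_Suc_shift) (simp add: A_def)
  finally have split: "(u - t)
        * (\<Sum>k\<le>n. real (n choose k) * central_ratio k * (- t) ^ k * u ^ (n - k))
      = u ^ Suc n + (\<Sum>k\<le>n. A (Suc k) + B k)"
    by (simp add: sum.distrib)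
  have coeff: "2 * (real n + 1) * (A (Suc k) + B k)
      = (2 * real n + 1)
        * (real (Suc n choose Suc k) * central_ratio (Suc k) * (- t) ^ Suc k * u ^ (n - k))" for k
  proof -
    define a b c where "a = real (n choose k)" and "b = real (n choose Suc k)"
      and "c = central_ratio (Suc k)"
    have B: "2 * (real k + 1) * (a * central_ratio k) = (2 * real k + 1) * (a * c)"
      using arg_cong [OF central_ratio_Suc [of k, symmetric], of "(*) a"]
      unfolding c_def by (simp only: mult_ac)
    have "real (Suc k * (Suc n choose Suc k)) = real (Suc n * (n choose k))"
      by (simp only: Suc_times_binomial)
    then have absorb: "(real k + 1) * (a + b) = (real n + 1) * a"
      by (simp add: a_def b_def algebra_simps)
    have "(real k + 1) * (2 * (real n + 1) * (b * c + a * central_ratio k))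
        = 2 * (real n + 1) * (real k + 1) * (b * c)
          + (real n + 1) * (2 * (real k + 1) * (a * central_ratio k))"
      by (simp add: algebra_simps)
    also have "\<dots> = 2 * (real n + 1) * c * ((real k + 1) * (a + b)) - c * ((real n + 1) * a)"
      unfolding B by (simp add: algebra_simps)
    also have "\<dots> = (real k + 1) * ((2 * real n + 1) * ((a + b) * c))"
      unfolding absorb [symmetric] by (simp add: algebra_simps)
    finally have "2 * (real n + 1) * (b * c + a * central_ratio k)
        = (2 * real n + 1) * ((a + b) * c)"
      by (simp del: of_nat_Suc add: add_eq_0_iff)
    then have "2 * (real n + 1) * (b * c + a * central_ratio k) * ((- t) ^ Suc k * u ^ (n - k))
        = (2 * real n + 1) * ((a + b) * c) * ((- t) ^ Suc k * u ^ (n - k))"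
      by simp
    moreover have "A (Suc k) + B k
        = (b * c + a * central_ratio k) * ((- t) ^ Suc k * u ^ (n - k))"
      unfolding A_def B_def a_def b_def c_def by (simp add: algebra_simps)
    moreover have "real (Suc n choose Suc k) = a + b"
      by (simp add: a_def b_def)
    ultimately show ?thesis
      by (simp only: c_def mult.assoc)
  qed
  have "(\<Sum>k\<le>Suc n. real (Suc n choose k) * central_ratio k * (- t) ^ k * u ^ (Suc n - k))
      = u ^ Suc n + (\<Sum>k\<le>n. real (Suc n choose Suc k) * central_ratio (Suc k)
          * (- t) ^ Suc k * u ^ (n - k))"
    by (subst sum.atMost_Suc_shift) simp
  moreover have "2 * (real n + 1) * (\<Sum>k\<le>n. A (Suc k) + B k)
      = (2 * real n + 1) * (\<Sum>k\<le>n. real (Suc n choose Suc k) * central_ratio (Suc k)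
          * (- t) ^ Suc k * u ^ (n - k))"
    unfolding sum_distrib_left by (rule sum.cong [OF refl coeff])
  ultimately show ?thesis
    unfolding mult.assoc split [unfolded mult.assoc] distrib_left
    by (simp add: algebra_simps)
qed

lemma binomial_odd_sum_eq_homogeneous:
  fixes t :: real
  shows "(\<Sum>k\<le>n. real (n choose k) * t ^ k / (2 * real k - 1))
    = - (\<Sum>k\<le>n. real (n choose k) * central_ratio k * (- t) ^ k * (1 + t) ^ (n - k))"
    (is "?P n = - ?R n")
proof (induction n)
  case (Suc n)
  have "(2 * real n + 1) * ?P (Suc n) = 2 * (real n + 1) * ?P n + (1 + t) ^ Suc n"
    by (rule binomial_odd_sum_Suc)
  also have "\<dots> = (2 * real n + 1) * - ?R (Suc n)"
    unfolding Suc.IH mult_minus_right homogeneous_central_sum_Suc [of n t "1 + t"] by simp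
  finally show ?case
    by (simp only: mult_cancel_left) simp
qed simp

lemma binomial_odd_sum_eq_shifted:
  fixes t :: real
  shows "(\<Sum>k\<le>n. real (n choose k) * t ^ k / (2 * real k - 1))
    = central_ratio n * (\<Sum>k\<le>n. (1 + t) ^ k / (central_ratio k * (2 * real k - 1)))"
    (is "?P n = central_ratio n * ?Q n")
proof (induction n)
  case (Suc n)
  have last: "(2 * real n + 1) * (central_ratio (Suc n)
      * ((1 + t) ^ Suc n / (central_ratio (Suc n) * (2 * real (Suc n) - 1)))) = (1 + t) ^ Suc n"
    using central_ratio_pos [of "Suc n"] odd_nonzero [of "Suc n"] by (simp add: add.commute)
  have "(2 * real n + 1) * ?P (Suc n) = 2 * (real n + 1) * ?P n + (1 + t) ^ Suc n"
    by (rule binomial_odd_sum_Suc)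
  also have "2 * (real n + 1) * ?P n = (2 * real n + 1) * central_ratio (Suc n) * ?Q n"
    by (simp only: Suc.IH central_ratio_Suc mult.assoc [symmetric])
  also have "\<dots> + (1 + t) ^ Suc n = (2 * real n + 1) * (central_ratio (Suc n) * ?Q (Suc n))"
    using last by (simp only: sum.atMost_Suc distrib_left mult.assoc)
  finally show ?case
    by (simp only: mult_cancel_left) simp
qed simp

section \<open>Binet's formulas at integer indices\<close>

definition golden :: real where "golden = (1 + sqrt 5) / 2"
definition golden_conj :: real where "golden_conj = (1 - sqrt 5) / 2"

lemma golden_roots:
  "golden ^ 2 = golden + 1" "golden_conj ^ 2 = golden_conj + 1"
  "golden * golden_conj = -1"
  by (simp_all add: golden_def golden_conj_def power2_eq_square field_simps)

lemma golden_nonzero: "golden \<noteq> 0" "golden_conj \<noteq> 0"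
  using golden_roots(3) by auto

lemma powi_fibonacci_rec:
  fixes z :: real
  assumes "z ^ 2 = z + 1"
  shows "z powi (m + 2) = z powi (m + 1) + z powi m"
proof -
  have "z \<noteq> 0" using assms by auto
  then show ?thesis using assms by (simp add: power_int_add algebra_simps)
qed

text \<open>A two-sided sequence is determined by the recursion and two consecutive values.\<close>

lemma fibonacci_recursion_unique:
  fixes f g :: "int \<Rightarrow> real"
  assumes f: "\<And>m. f (m + 2) = f (m + 1) + f m" and g: "\<And>m. g (m + 2) = g (m + 1) + g m"
    and "f 0 = g 0" "f 1 = g 1"
  shows "f m = g m"
proof -
  have "f m = g m \<and> f (m + 1) = g (m + 1)"
  proof (induction m rule: int_induct [where k = 0])
    case base
    then show ?case using assms(3,4) by simp
  next
    case (step1 m)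
    then show ?case using f [of m] g [of m] by (simp add: add.assoc)
  next
    case (step2 m)
    then show ?case using f [of "m - 1"] g [of "m - 1"] by (simp add: algebra_simps)
  qed
  then show ?thesis ..
qed

lemma fibonacci_Binet:
  "real_of_int (fibonacci m) = (golden powi m - golden_conj powi m) / sqrt 5"
  by (rule fibonacci_recursion_unique [where f = "\<lambda>m. real_of_int (fibonacci m)"])
    (simp_all add: fibonacci_rec powi_fibonacci_rec golden_roots add_divide_distrib
      diff_divide_distrib, simp add: golden_def golden_conj_def diff_divide_distrib [symmetric])

lemma lucas_Binet: "real_of_int (lucas m) = golden powi m + golden_conj powi m"
  by (rule fibonacci_recursion_unique [where f = "\<lambda>m. real_of_int (lucas m)"])
    (simp_all add: lucas_rec powi_fibonacci_rec golden_roots,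
      simp add: golden_def golden_conj_def add_divide_distrib [symmetric])

section \<open>The Fibonacci and Lucas identities\<close>

theorem proposition6p2:
  fixes r :: int and n :: nat
  shows
    "(-1 :: real) powi (r * int n) *
       (\<Sum>k=0..n. real (n choose k) / real ((2 * k) choose k) * 2 ^ (2 * k) * (-1) ^ (k + 1)
          * real_of_int (lucas r) ^ (n - k) * real_of_int (fibonacci (r * int (n + k))))
     = (\<Sum>k=0..n. real (n choose k) * (-1) powi (r * int k)
          * (real_of_int (fibonacci (2 * r * int k)) / (2 * real k - 1)))
     \<and>
     (\<Sum>k=0..n. real (n choose k) * (-1) powi (r * int k)
          * (real_of_int (fibonacci (2 * r * int k)) / (2 * real k - 1)))
     = 2 ^ (2 * n) / real ((2 * n) choose n) *
       (\<Sum>k=0..n. real ((2 * k) choose k) * (-1) powi (r * int k)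
          * (2 powi (- 2 * int k) * real_of_int (fibonacci (r * int k)) * real_of_int (lucas r) ^ k
             / (2 * real k - 1)))"
    (is "?first = ?middle \<and> ?middle = ?last")
proof -
  define x y e L where "x = golden powi r" and "y = golden_conj powi r"
    and "e = (-1 :: real) powi r" and "L = real_of_int (lucas r)"
  have xy: "x * y = e"
    by (simp add: x_def y_def e_def power_int_mult_distrib [symmetric] golden_roots)
  have ee: "e * e = 1"
    by (simp add: e_def power_int_mult_distrib [symmetric])
  have L: "L = x + y"
    by (simp add: L_def x_def y_def lucas_Binet)
  have fib: "real_of_int (fibonacci (r * int m)) = (x ^ m - y ^ m) / sqrt 5" for m
    by (simp add: fibonacci_Binet x_def y_def power_int_mult)
  have fib2: "real_of_int (fibonacci (2 * r * int m)) = (x ^ (2 * m) - y ^ (2 * m)) / sqrt 5" for m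
    using fib [of "2 * m"] by (simp add: ac_simps)
  have e_pow: "(-1) powi (r * int m) = e ^ m" for m
    by (simp add: e_def power_int_mult)
  have two_pow: "(2 :: real) ^ (2 * k) = 4 ^ k" for k
    by (simp add: power_mult)
  have two_powi: "(2 :: real) powi (- 2 * int k) = 1 / 4 ^ k" for k
    using power_int_minus [of "2 :: real" "int (2 * k)"]
    by (simp add: power_int_mult power_mult divide_inverse)

  define P where "P t = (\<Sum>k\<le>n. real (n choose k) * t ^ k / (2 * real k - 1))" for t
  have shift: "1 + e * x ^ 2 = e * x * L" "1 + e * y ^ 2 = e * y * L"
    \<comment> \<open>\<open>e x L = e x\<^sup>2 + e x y\<close>, and \<open>e x y = e\<^sup>2 = 1\<close>\<close>
    using ee xy by (simp_all add: L power2_eq_square algebra_simps)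

  \<comment> \<open>The three sums are now written through Binet's formula; here \<open>e\<^sup>k x\<^bsup>2k\<^esup> = (e x\<^sup>2)\<^sup>k\<close>.\<close>
  have split_term: "c * d * ((a - b) / s / q) = (c * (d * a) / q - c * (d * b) / q) / s"
    for a b c d q s :: real
    by (simp add: diff_divide_distrib right_diff_distrib mult_ac)
  have middle: "?middle = (P (e * x ^ 2) - P (e * y ^ 2)) / sqrt 5"
    unfolding P_def sum_subtractf [symmetric] sum_divide_distrib atLeast0AtMost
    by (rule sum.cong [OF refl])
      (simp only: fib2 e_pow power_mult_distrib power_mult [symmetric] split_term)

  have first_term: "(e * z ^ 2) ^ k * (e * z * L) ^ (n - k) = e ^ n * L ^ (n - k) * z ^ (n + k)"
    if "k \<le> n" for k z
  proof -
    have "(e * z ^ 2) ^ k * (e * z * L) ^ (n - k)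
        = e ^ (k + (n - k)) * L ^ (n - k) * z ^ (2 * k + (n - k))"
      by (simp only: power_mult_distrib power_mult [symmetric] power_add mult_ac)
    moreover have "k + (n - k) = n" "2 * k + (n - k) = n + k" using that by simp_all
    ultimately show ?thesis by simp
  qed
  have first_sum: "P (e * z ^ 2) = e ^ n * (\<Sum>k\<le>n. real (n choose k) * central_ratio k
      * (-1) ^ (k + 1) * L ^ (n - k) * z ^ (n + k))"
    if z: "1 + e * z ^ 2 = e * z * L" for z
    unfolding P_def binomial_odd_sum_eq_homogeneous z sum_distrib_left sum_negf [symmetric]
  proof (rule sum.cong [OF refl])
    fix k assume "k \<in> {..n}"
    then have "(e * z ^ 2) ^ k * (e * z * L) ^ (n - k) = e ^ n * L ^ (n - k) * z ^ (n + k)"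
      using first_term by simp
    then have "- (real (n choose k) * central_ratio k * (-1) ^ k)
          * ((e * z ^ 2) ^ k * (e * z * L) ^ (n - k))
        = - (real (n choose k) * central_ratio k * (-1) ^ k)
          * (e ^ n * L ^ (n - k) * z ^ (n + k))"
      by simp
    then show "- (real (n choose k) * central_ratio k * (- (e * z ^ 2)) ^ k
          * (e * z * L) ^ (n - k))
        = e ^ n * (real (n choose k) * central_ratio k * (-1) ^ (k + 1) * L ^ (n - k)
          * z ^ (n + k))"
      unfolding power_minus [of "e * z ^ 2"] by (simp add: mult_ac)
  qed
  have first: "?first = (P (e * x ^ 2) - P (e * y ^ 2)) / sqrt 5"
    unfolding first_sum [OF shift(1)] first_sum [OF shift(2)] right_diff_distrib [symmetric]
      sum_subtractf [symmetric] times_divide_eq_right [symmetric] sum_divide_distrib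
      e_pow atLeast0AtMost
    by (rule arg_cong [where f = "(*) _"], rule sum.cong [OF refl],
      simp only: fib two_pow L_def central_ratio_def,
      simp add: mult_ac right_diff_distrib diff_divide_distrib)

  have last_sum: "P (e * z ^ 2) = central_ratio n
      * (\<Sum>k\<le>n. e ^ k * z ^ k * L ^ k / (central_ratio k * (2 * real k - 1)))"
    if z: "1 + e * z ^ 2 = e * z * L" for z
    unfolding P_def binomial_odd_sum_eq_shifted z by (simp add: power_mult_distrib)
  have split_last: "b * d * (1 / f * ((u - v) / s) * (l / q))
      = (d * u * (l / (f / b * q)) - d * v * (l / (f / b * q))) / s" for b d f u v s l q :: real
    by (simp add: diff_divide_distrib right_diff_distrib left_diff_distrib mult_ac)
  have last: "?last = (P (e * x ^ 2) - P (e * y ^ 2)) / sqrt 5"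
    unfolding last_sum [OF shift(1)] last_sum [OF shift(2)] right_diff_distrib [symmetric]
      sum_subtractf [symmetric] times_divide_eq_right [symmetric] sum_divide_distrib
      e_pow atLeast0AtMost two_pow two_powi central_ratio_def [of n]
    by (rule arg_cong [where f = "(*) _"], rule sum.cong [OF refl],
      simp only: fib L_def central_ratio_def split_last)
  show ?thesis using first middle last by simp
qed

end
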